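(* Let $X$ be a finite cell complex, let $q$ be a prime integer, let $i\ge 0$ be an integer, and let $\beta_2,\beta_1\geq 0$. Put $p_2=1-e^{-\beta_2}$, $p_1=1-e^{-\beta_1}$, $k_2=\frac{p_2}{1-p_2}=e^{\beta_2}-1$ and $k_1=\frac{p_1}{1-p_1}=e^{\beta_1}-1$. Let $\kappa$ be the probability measure on $C^i(X;\mathbb{Z}_q)\times \Xi^{i+1}(X)\times \Xi^{i}(X)$ defined by $$\kappa(f,P_2,P_1)\propto \prod_{\epsilon\in X^{[i]}}\Bigl[I_0\bigl(P_1(\epsilon)\bigr)+k_1\, P_1(\epsilon)\, I_0\bigl(f(\epsilon)\bigr)\Bigr]\cdot \prod_{\sigma\in X^{[i+1]}}\Bigl[I_0\bigl(P_2(\sigma)\bigr)+k_2\, P_2(\sigma)\, I_0\bigl(\delta f(\sigma)\bigr)\Bigr].$$ Then $\kappa$ is a coupling satisfying the following. (1) The marginal distribution of $f$ is the Potts lattice Higgs model $\mu_{\beta_2,\beta_1,q,i,X}$. (2) The marginal distribution of $(P_2,P_1)$ is the coupled plaquette percolation $\rho_{p_2,p_1,q,i,X}$. (3) The conditional distribution of $(P_2,P_1)$ given $f$ is independent percolation with probability $p_2$ on the set of $(i+1)$-cells $\sigma$ such that $\delta f(\sigma)=0$ and with probability $p_1$ on the set of $i$-cells $\epsilon$ such that $f(\epsilon)=0$ (all other $(i+1)$-cells and $i$-cells being absent). (4) The conditional distribution of $f$ given $(P_2,P_1)$ is the uniform measure on $Z^{i}(P_2,P_1;\mathbb{Z}_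q)$.
   Context: For a cell complex $X$: $X^{[j]}$ is the set of $j$-cells and $X^{(j)}$ the $j$-skeleton. $C^j(X;\mathbb{Z}_q)$ is the group of functions $f$ from oriented $j$-cells to $\mathbb{Z}_q$ (integers modulo $q$) with $f(-x)=-f(x)$, where $-x$ is $x$ with reversed orientation; such $f$ is evaluated on $j$-chains by linearity. The coboundary is $\delta f(x)=f(\partial x)$, with $\partial$ the cellular boundary map. $I_x(y)$ is the indicator that $y=x$. A $j$-dimensional percolation subcomplex of $X$ is a subcomplex $P$ with $X^{(j-1)}\subseteq P\subseteq X^{(j)}$; $|P|$ is its number of $j$-cells, and $P(x)=1$ if the $j$-cell $x$ is in $P$ and $P(x)=0$ otherwise. $\Xi^j(X)$ is the collection of all $j$-dimensional percolation subcomplexes of $X$. The Potts lattice Higgs model $\mu_{\beta_2,\beta_1,q,i,X}$ is the Gibbs measure on $C^i(X;\mathbb{Z}_q)$, $\mu(f)\propto e^{-\mathcal{H}(f)}$, with $\mathcal{H}(f)=-\beta_2\sum_{\sigma\in X^{[i+1]}}I_0(\delta f(\sigma))-\beta_1\sum_{\epsilon\in X^{[i]}}I_0(f(\epsilon))$. For percolation subcomplexes $P_2$ and $P_1$ of dimensions $i+1$ and $i$, the relative cocycle group is $Z^i(P_2,P_1;\mathbb{Z}_q)=\{f\in C^i(X;\mathbb{Z}_q): f(\epsilon)=0 \text{ for all } i\text{-cells }\epsilon\in P_1,\ \delta f(\sigma)=0\text{ for all }(i+1)\text{-cells }\sigma\in P_2\}$; it coincides with the relative cohomology $H^i(P_2,P_1;\mathbb{Z}_q)$.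 The coupled plaquette percolation $\rho_{p_2,p_1,q,i,X}$ is the probability measure on $\Xi^{i+1}(X)\times\Xi^i(X)$ with $$\rho(P_2,P_1)\propto p_2^{|P_2|}(1-p_2)^{|X^{[i+1]}|-|P_2|}\,p_1^{|P_1|}(1-p_1)^{|X^{[i]}|-|P_1|}\,|H^i(P_2,P_1;\mathbb{Z}_q)|.$$ *)

theory Defs
  imports "HOL-Homology.Homology" "HOL-Probability.Probability"
begin

section \<open>Finite cell complexes\<close>

text \<open>The closed ball of dimension \<open>n\<close> and its bounding sphere, inside the library's
  \<^const>\<open>Euclidean_space\<close> (functions on the naturals vanishing from \<open>n\<close> on), so that balls
  of all dimensions live in one type. For \<open>n = 0\<close> the ball is a point and the sphere is empty.\<close>

definition closed_disk :: "nat \<Rightarrow> (nat \<Rightarrow> real) set" where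
  "closed_disk n = {x \<in> topspace (Euclidean_space n). (\<Sum>k<n. x k ^ 2) \<le> 1}"

definition open_disk :: "nat \<Rightarrow> (nat \<Rightarrow> real) set" where
  "open_disk n = {x \<in> topspace (Euclidean_space n). (\<Sum>k<n. x k ^ 2) < 1}"

definition disk_sphere :: "nat \<Rightarrow> (nat \<Rightarrow> real) set" where
  "disk_sphere n = closed_disk n - open_disk n"

definition disk_topology :: "nat \<Rightarrow> (nat \<Rightarrow> real) topology" where
  "disk_topology n = subtopology (Euclidean_space n) (closed_disk n)"

text \<open>The cells are given by names in \<open>'c\<close>, each with a dimension and a characteristic map.\<close>

record ('a, 'c) cell_complex =
  space_of :: "'a topology"
  cells :: "'c set"
  cell_dim :: "'c \<Rightarrow> nat"
  char_map :: "'c \<Rightarrow> (nat \<Rightarrow> real) \<Rightarrow> 'a"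

definition open_cell :: "('a, 'c) cell_complex \<Rightarrow> 'c \<Rightarrow> 'a set" where
  "open_cell X c = char_map X c ` open_disk (cell_dim X c)"

definition realization :: "('a, 'c) cell_complex \<Rightarrow> 'c set \<Rightarrow> 'a set" where
  "realization X A = (\<Union>c\<in>A. open_cell X c)"

text \<open>Finite CW complexes. Since there are finitely many cells and the space is Hausdorff, the
  closure-finiteness and weak topology conditions hold automatically, and every characteristic map
  is a homeomorphism from the open ball onto the open cell.\<close>

definition finite_cell_complex :: "('a, 'c) cell_complex \<Rightarrow> bool" where
  "finite_cell_complex X \<longleftrightarrow>
     finite (cells X) \<and>
     Hausdorff_space (space_of X) \<and>
     (\<forall>c\<in>cells X. continuous_map (disk_topology (cell_dim X c)) (space_of X) (char_map X c)) \<and>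
     (\<forall>c\<in>cells X. inj_on (char_map X c) (open_disk (cell_dim X c))) \<and>
     disjoint_family_on (open_cell X) (cells X) \<and>
     realization X (cells X) = topspace (space_of X) \<and>
     (\<forall>c\<in>cells X. char_map X c ` disk_sphere (cell_dim X c)
                     \<subseteq> realization X {d \<in> cells X. cell_dim X d < cell_dim X c})"

definition cells_of_dim :: "('a, 'c) cell_complex \<Rightarrow> nat \<Rightarrow> 'c set" where
  "cells_of_dim X j = {c \<in> cells X. cell_dim X c = j}"

text \<open>A subcomplex is identified with its set of cells. The skeleton is indexed by an integer
  because the (empty) skeleton of dimension \<open>-1\<close> is needed.\<close>

definition skeleton :: "('a, 'c) cell_complex \<Rightarrow> int \<Rightarrow> 'c set" where
  "skeleton X k = {c \<in> cells X. int (cell_dim X c) \<le> k}"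

definition subcomplex :: "('a, 'c) cell_complex \<Rightarrow> 'c set \<Rightarrow> bool" where
  "subcomplex X A \<longleftrightarrow>
     A \<subseteq> cells X \<and> (\<forall>c\<in>A. char_map X c ` closed_disk (cell_dim X c) \<subseteq> realization X A)"


section \<open>The cellular boundary map\<close>

definition skeleton_topology :: "('a, 'c) cell_complex \<Rightarrow> int \<Rightarrow> 'a topology" where
  "skeleton_topology X k = subtopology (space_of X) (realization X (skeleton X k))"

definition cellular_homology :: "('a, 'c) cell_complex \<Rightarrow> nat \<Rightarrow> 'a chain set monoid" where
  "cellular_homology X j =
     relative_homology_group (int j) (skeleton_topology X (int j))
       (realization X (skeleton X (int j - 1)))"

text \<open>A generator of the infinite cyclic homology group of a ball relative to its sphere, fixed
  once for each dimension. The other choice reverses all reference orientations in that dimension.\<close>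

definition disk_class :: "nat \<Rightarrow> (nat \<Rightarrow> real) chain set" where
  "disk_class n =
     (let G = relative_homology_group (int n) (disk_topology n) (disk_sphere n)
      in SOME g. g \<in> carrier G \<and> subgroup_generated G {g} = G)"

definition cell_class :: "('a, 'c) cell_complex \<Rightarrow> 'c \<Rightarrow> 'a chain set" where
  "cell_class X c =
     (let n = cell_dim X c
      in hom_induced (int n) (disk_topology n) (disk_sphere n)
           (skeleton_topology X (int n)) (realization X (skeleton X (int n - 1)))
           (char_map X c) (disk_class n))"

definition cellular_chains :: "('a, 'c) cell_complex \<Rightarrow> nat \<Rightarrow> ('c \<Rightarrow>\<^sub>0 int) set" where
  "cellular_chains X j = carrier (free_Abelian_group (cells_of_dim X j))"

text \<open>The classes of the \<open>j\<close>-cells form a basis of \<^const>\<open>cellular_homology\<close>; this is the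
  resulting identification of integral cellular chains with homology classes.\<close>

definition chain_class :: "('a, 'c) cell_complex \<Rightarrow> nat \<Rightarrow> ('c \<Rightarrow>\<^sub>0 int) \<Rightarrow> 'a chain set" where
  "chain_class X j z =
     finprod (cellular_homology X j)
       (\<lambda>c. cell_class X c [^]\<^bsub>cellular_homology X j\<^esub> Poly_Mapping.lookup z c) (cells_of_dim X j)"

text \<open>The boundary of a \<open>(j+1)\<close>-cell with its reference orientation: the connecting homomorphism
  of the triple of consecutive skeleta, read in the basis of \<open>j\<close>-cells.\<close>

definition cell_boundary :: "('a, 'c) cell_complex \<Rightarrow> nat \<Rightarrow> 'c \<Rightarrow> ('c \<Rightarrow>\<^sub>0 int)" where
  "cell_boundary X j c =
     (THE z. z \<in> cellular_chains X j \<and>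
        chain_class X j z =
          hom_relboundary (int (j + 1)) (skeleton_topology X (int (j + 1)))
            (realization X (skeleton X (int j))) (realization X (skeleton X (int j - 1)))
            (cell_class X c))"


section \<open>Cochains with coefficients in the integers modulo \<open>q\<close>\<close>

text \<open>\<open>Pos\<close> is the reference orientation, transported by the characteristic map.\<close>

datatype orientation = Pos | Neg

fun orientation_sign :: "orientation \<Rightarrow> int" where
  "orientation_sign Pos = 1"
| "orientation_sign Neg = - 1"

fun reverse_cell :: "'c \<times> orientation \<Rightarrow> 'c \<times> orientation" where
  "reverse_cell (c, Pos) = (c, Neg)"
| "reverse_cell (c, Neg) = (c, Pos)"

definition oriented_cells :: "('a, 'c) cell_complex \<Rightarrow> nat \<Rightarrow> ('c \<times> orientation) set" where
  "oriented_cells X j = cells_of_dim X j \<times> UNIV"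

definition oriented_boundary ::
  "('a, 'c) cell_complex \<Rightarrow> nat \<Rightarrow> 'c \<times> orientation \<Rightarrow> ('c \<Rightarrow>\<^sub>0 int)" where
  "oriented_boundary X j x = frag_cmul (orientation_sign (snd x)) (cell_boundary X j (fst x))"

text \<open>The integers modulo \<open>q\<close> are represented by \<open>{0..<q}\<close>. Cochains are extended by \<open>0\<close>
  outside the oriented \<open>j\<close>-cells, so that equality of cochains is equality of functions.\<close>

type_synonym 'c cochain = "'c \<times> orientation \<Rightarrow> int"

definition cochains :: "('a, 'c) cell_complex \<Rightarrow> int \<Rightarrow> nat \<Rightarrow> 'c cochain set" where
  "cochains X q j =
     {f. (\<forall>x\<in>oriented_cells X j. f x \<in> {0..<q} \<and> f (reverse_cell x) = (- f x) mod q) \<and>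
         (\<forall>x. x \<notin> oriented_cells X j \<longrightarrow> f x = 0)}"

definition eval_chain :: "int \<Rightarrow> 'c cochain \<Rightarrow> ('c \<Rightarrow>\<^sub>0 int) \<Rightarrow> int" where
  "eval_chain q f z =
     (\<Sum>c\<in>Poly_Mapping.keys z. Poly_Mapping.lookup z c * f (c, Pos)) mod q"

definition coboundary ::
  "('a, 'c) cell_complex \<Rightarrow> int \<Rightarrow> nat \<Rightarrow> 'c cochain \<Rightarrow> 'c cochain" where
  "coboundary X q j f =
     (\<lambda>x. if x \<in> oriented_cells X (j + 1) then eval_chain q f (oriented_boundary X j x) else 0)"

text \<open>Relative cohomology of a pair of subcomplexes \<open>B \<subseteq> A\<close>: cochains on \<open>A\<close> that vanish
  on \<open>B\<close>. Vanishing on a cell does not depend on its orientation.\<close>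

definition relative_cochains ::
  "('a, 'c) cell_complex \<Rightarrow> int \<Rightarrow> nat \<Rightarrow> 'c set \<Rightarrow> 'c set \<Rightarrow> 'c cochain set" where
  "relative_cochains X q j A B =
     {f \<in> cochains X q j. \<forall>c\<in>cells_of_dim X j. c \<notin> A \<or> c \<in> B \<longrightarrow> f (c, Pos) = 0}"

definition relative_cocycles ::
  "('a, 'c) cell_complex \<Rightarrow> int \<Rightarrow> nat \<Rightarrow> 'c set \<Rightarrow> 'c set \<Rightarrow> 'c cochain set" where
  "relative_cocycles X q j A B =
     {f \<in> relative_cochains X q j A B.
        \<forall>c\<in>cells_of_dim X (j + 1) \<inter> A. coboundary X q j f (c, Pos) = 0}"

definition relative_coboundaries ::
  "('a, 'c) cell_complex \<Rightarrow> int \<Rightarrow> nat \<Rightarrow> 'c set \<Rightarrow> 'c set \<Rightarrow> 'c cochain set" where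
  "relative_coboundaries X q j A B =
     (case j of
        0 \<Rightarrow> {\<lambda>_. 0}
      | Suc k \<Rightarrow> (\<lambda>f x. if fst x \<in> A then coboundary X q k f x else 0) ` relative_cochains X q k A B)"

definition cocycle_group ::
  "('a, 'c) cell_complex \<Rightarrow> int \<Rightarrow> nat \<Rightarrow> 'c set \<Rightarrow> 'c set \<Rightarrow> 'c cochain monoid" where
  "cocycle_group X q j A B =
     \<lparr>carrier = relative_cocycles X q j A B,
      monoid.mult = (\<lambda>f g x. (f x + g x) mod q),
      one = (\<lambda>_. 0)\<rparr>"

definition relative_cohomology ::
  "('a, 'c) cell_complex \<Rightarrow> int \<Rightarrow> nat \<Rightarrow> 'c set \<Rightarrow> 'c set \<Rightarrow> 'c cochain set monoid" where
  "relative_cohomology X q j A B = cocycle_group X q j A B Mod relative_coboundaries X q j A B"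


section \<open>Percolation subcomplexes and probability measures\<close>

definition percolation_subcomplexes :: "('a, 'c) cell_complex \<Rightarrow> nat \<Rightarrow> 'c set set" where
  "percolation_subcomplexes X j =
     {P. subcomplex X P \<and> skeleton X (int j - 1) \<subseteq> P \<and> P \<subseteq> skeleton X (int j)}"

definition num_cells :: "('a, 'c) cell_complex \<Rightarrow> nat \<Rightarrow> 'c set \<Rightarrow> nat" where
  "num_cells X j P = card (P \<inter> cells_of_dim X j)"

definition cell_state :: "'c set \<Rightarrow> 'c \<Rightarrow> int" where
  "cell_state P c = of_bool (c \<in> P)"

definition I0 :: "int \<Rightarrow> real" where
  "I0 y = indicator {0} y"

text \<open>For percolation subcomplexes, the relative cocycles are the cochains on the whole complex
  subject to the two vanishing conditions.\<close>

lemma relative_cocycles_percolation: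
  assumes "P2 \<in> percolation_subcomplexes X (i + 1)"
  shows "relative_cocycles X q i P2 P1 =
    {f \<in> cochains X q i.
       (\<forall>e\<in>cells_of_dim X i. e \<in> P1 \<longrightarrow> f (e, Pos) = 0) \<and>
       (\<forall>s\<in>cells_of_dim X (i + 1). s \<in> P2 \<longrightarrow> coboundary X q i f (s, Pos) = 0)}"
proof -
  have "cells_of_dim X i \<subseteq> P2"
    using assms by (auto simp: percolation_subcomplexes_def skeleton_def cells_of_dim_def)
  then show ?thesis
    by (auto simp: relative_cocycles_def relative_cochains_def)
qed

text \<open>The probability distribution on a finite set \<open>S\<close> proportional to a weight \<open>w\<close>.\<close>

definition proportional_pmf :: "'x set \<Rightarrow> ('x \<Rightarrow> real) \<Rightarrow> 'x pmf" where
  "proportional_pmf S w = embed_pmf (\<lambda>x. if x \<in> S then w x / (\<Sum>y\<in>S. w y) else 0)"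

lemma pmf_proportional_pmf:
  assumes "finite S" "\<And>x. x \<in> S \<Longrightarrow> 0 \<le> w x" "0 < (\<Sum>y\<in>S. w y)"
  shows "pmf (proportional_pmf S w) x = (if x \<in> S then w x / (\<Sum>y\<in>S. w y) else 0)"
proof -
  let ?g = "\<lambda>x. if x \<in> S then w x / (\<Sum>y\<in>S. w y) else 0"
  have nonneg: "0 \<le> ?g x" for x
    using assms by (auto intro!: divide_nonneg_pos)
  have "(\<integral>\<^sup>+ x. ennreal (?g x) \<partial>count_space UNIV) = (\<Sum>x\<in>S. ennreal (?g x))"
    using assms(1) by (intro nn_integral_count_space'[where A = S]) auto
  also have "\<dots> = ennreal (\<Sum>x\<in>S. ?g x)"
    by (rule sum_ennreal) (rule nonneg)
  also have "(\<Sum>x\<in>S. ?g x) = 1"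
    using assms(3) by (simp flip: sum_divide_distrib)
  finally show ?thesis
    unfolding proportional_pmf_def using nonneg by (subst pmf_embed_pmf) auto
qed

definition higgs_hamiltonian ::
  "real \<Rightarrow> real \<Rightarrow> int \<Rightarrow> nat \<Rightarrow> ('a, 'c) cell_complex \<Rightarrow> 'c cochain \<Rightarrow> real" where
  "higgs_hamiltonian \<beta>2 \<beta>1 q i X f =
     - \<beta>2 * (\<Sum>\<sigma>\<in>cells_of_dim X (i + 1). I0 (coboundary X q i f (\<sigma>, Pos)))
     - \<beta>1 * (\<Sum>\<epsilon>\<in>cells_of_dim X i. I0 (f (\<epsilon>, Pos)))"

definition potts_lattice_higgs ::
  "real \<Rightarrow> real \<Rightarrow> int \<Rightarrow> nat \<Rightarrow> ('a, 'c) cell_complex \<Rightarrow> 'c cochain pmf" where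
  "potts_lattice_higgs \<beta>2 \<beta>1 q i X =
     proportional_pmf (cochains X q i) (\<lambda>f. exp (- higgs_hamiltonian \<beta>2 \<beta>1 q i X f))"

definition coupled_plaquette_percolation ::
  "real \<Rightarrow> real \<Rightarrow> int \<Rightarrow> nat \<Rightarrow> ('a, 'c) cell_complex \<Rightarrow> ('c set \<times> 'c set) pmf" where
  "coupled_plaquette_percolation p2 p1 q i X =
     proportional_pmf (percolation_subcomplexes X (i + 1) \<times> percolation_subcomplexes X i)
       (\<lambda>(P2, P1).
          p2 ^ num_cells X (i + 1) P2
          * (1 - p2) ^ (card (cells_of_dim X (i + 1)) - num_cells X (i + 1) P2)
          * p1 ^ num_cells X i P1
          * (1 - p1) ^ (card (cells_of_dim X i) - num_cells X i P1)
          * real (Coset.order (relative_cohomology X q i P2 P1)))"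

definition higgs_coupling ::
  "real \<Rightarrow> real \<Rightarrow> int \<Rightarrow> nat \<Rightarrow> ('a, 'c) cell_complex
     \<Rightarrow> ('c cochain \<times> 'c set \<times> 'c set) pmf" where
  "higgs_coupling k2 k1 q i X =
     proportional_pmf
       (cochains X q i \<times> percolation_subcomplexes X (i + 1) \<times> percolation_subcomplexes X i)
       (\<lambda>(f, P2, P1).
          (\<Prod>\<epsilon>\<in>cells_of_dim X i.
             I0 (cell_state P1 \<epsilon>) + k1 * of_int (cell_state P1 \<epsilon>) * I0 (f (\<epsilon>, Pos)))
          * (\<Prod>\<sigma>\<in>cells_of_dim X (i + 1).
             I0 (cell_state P2 \<sigma>)
             + k2 * of_int (cell_state P2 \<sigma>) * I0 (coboundary X q i f (\<sigma>, Pos))))"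

text \<open>Each cell of \<open>S\<close>, a set of \<open>j\<close>-cells, is present independently with probability \<open>p\<close>;
  the other \<open>j\<close>-cells are absent and all cells of lower dimension are present.\<close>

definition independent_percolation ::
  "('a, 'c) cell_complex \<Rightarrow> nat \<Rightarrow> real \<Rightarrow> 'c set \<Rightarrow> 'c set pmf" where
  "independent_percolation X j p S =
     map_pmf (\<lambda>\<omega>. skeleton X (int j - 1) \<union> {c \<in> S. \<omega> c})
       (Pi_pmf S False (\<lambda>_. bernoulli_pmf p))"

end

theory Submission
  imports Defs
begin

text \<open>
  The unnormalised joint weight of \<open>(f, P2, P1)\<close> is a product of local factors, one for each cell of
  dimension \<open>i\<close> or \<open>i + 1\<close>. A cell \<open>c\<close> carries a value \<open>a c\<close>, which is \<open>f\<close> on \<open>i\<close>-cells and the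
  coboundary of \<open>f\<close> on \<open>(i + 1)\<close>-cells, and its factor is \<open>1\<close> if the cell is closed, \<open>k\<close> if it is open
  and satisfied (\<open>a c = 0\<close>), and \<open>0\<close> if it is open and not satisfied. Everything follows by reading this
  product in two ways, as in the Edwards--Sokal coupling of the Potts and random-cluster models.

  With \<open>f\<close> fixed, the cells are open or closed without constraint, because every set of \<open>j\<close>-cells
  together with the \<open>(j - 1)\<close>-skeleton is a subcomplex. Summing over the two states of each cell gives
  the product of \<open>1 + k * I0 (a c)\<close>, which for \<open>k = exp \<beta> - 1\<close> is \<open>exp (\<beta> * I0 (a c))\<close>: this is the Gibbs
  weight (\<open>sum_cell_weight_exp\<close>). The product form also says that, given \<open>f\<close>, the cells are
  independent, a satisfied cell being open with odds \<open>k = p / (1 - p)\<close> and any other cell being closed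
  (\<open>independent_percolation_eq\<close>).

  With \<open>(P2, P1)\<close> fixed, the weight is \<open>k1 ^ |P1| * k2 ^ |P2|\<close> if \<open>f\<close> is a relative cocycle and \<open>0\<close>
  otherwise (\<open>cell_weights_relative_cocycles\<close>). So \<open>f\<close> is uniform on the relative cocycles, and summing
  over \<open>f\<close> yields the number of cocycles. That number is the order of the relative cohomology, because
  \<open>P1\<close> contains every \<open>(i - 1)\<close>-cell and hence the only relative coboundary is zero
  (\<open>order_relative_cohomology\<close>). The powers of \<open>k\<close> and of \<open>p\<close>, \<open>1 - p\<close> differ by the constant
  \<open>(1 - p) ^ n\<close>, with \<open>n\<close> the number of cells of that dimension (\<open>bernoulli_weight\<close>).

  The statements about distributions reduce to such identities between weights, since marginals,
  conditionals and independent products of distributions given up to normalisation are again given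
  by weights.
\<close>

section \<open>Distributions proportional to a weight\<close>

text \<open>The normalising constants never have to be computed: it is enough that the weights of the fibres
  are proportional to the target weight, since both sides have total mass one.\<close>

lemma map_proportional_pmf:
  assumes S: "finite S" "\<And>s. s \<in> S \<Longrightarrow> 0 \<le> w s" "0 < sum w S"
    and T: "finite T" "g ` S \<subseteq> T" and c: "0 < c"
    and fibre: "\<And>t. t \<in> T \<Longrightarrow> (\<Sum>s\<in>{s \<in> S. g s = t}. w s) = c * v t"
  shows "map_pmf g (proportional_pmf S w) = proportional_pmf T v"
proof (rule pmf_eqI)
  fix t
  have "0 \<le> c * v t" if "t \<in> T" for t
    using fibre[OF that] S(2) by (metis (no_types, lifting) mem_Collect_eq sum_nonneg)
  then have v: "0 \<le> v t" if "t \<in> T" for t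
    using that c by (simp add: zero_le_mult_iff)
  have "sum w S = (\<Sum>t\<in>T. \<Sum>s\<in>{s \<in> S. g s = t}. w s)"
    by (rule sum.group[OF S(1) T, symmetric])
  also have "\<dots> = c * sum v T"
    by (simp add: fibre sum_distrib_left)
  finally have total: "sum w S = c * sum v T" .
  then have "0 < sum v T"
    using S(3) c by (simp add: zero_less_mult_iff)
  note pmf_T = pmf_proportional_pmf[OF T(1) v this]
  note pmf_S = pmf_proportional_pmf[OF S]
  have supp: "set_pmf (proportional_pmf S w) \<subseteq> S"
    by (auto simp: set_pmf_iff pmf_S split: if_splits)
  have "pmf (map_pmf g (proportional_pmf S w)) t
      = measure (proportional_pmf S w) {s \<in> S. g s = t}"
    unfolding pmf_map using supp
    by (intro measure_pmf.finite_measure_eq_AE) (auto simp: AE_measure_pmf_iff)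
  also have "\<dots> = (\<Sum>s\<in>{s \<in> S. g s = t}. w s / sum w S)"
    using S(1) by (simp add: measure_measure_pmf_finite pmf_S)
  also have "\<dots> = (\<Sum>s\<in>{s \<in> S. g s = t}. w s) / sum w S"
    by (simp add: sum_divide_distrib)
  also have "\<dots> = pmf (proportional_pmf T v) t"
  proof (cases "t \<in> T")
    case True
    then show ?thesis using c by (simp add: fibre total pmf_T)
  next
    case False
    then have fibre_empty: "{s \<in> S. g s = t} = {}" using T(2) by auto
    show ?thesis unfolding fibre_empty using False by (simp add: pmf_T)
  qed
  finally show "pmf (map_pmf g (proportional_pmf S w)) t = pmf (proportional_pmf T v) t" .
qed

lemma cond_proportional_pmf:
  assumes S: "finite S" "\<And>s. s \<in> S \<Longrightarrow> 0 \<le> w s" and A: "0 < sum w (S \<inter> A)"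
  shows "cond_pmf (proportional_pmf S w) A = proportional_pmf (S \<inter> A) w"
proof (rule pmf_eqI)
  fix x
  have "sum w (S \<inter> A) \<le> sum w S"
    using S by (intro sum_mono2) auto
  with A have pos: "0 < sum w S" by simp
  note pmf_S = pmf_proportional_pmf[OF S pos]
  obtain y where "y \<in> S \<inter> A" "w y \<noteq> 0"
    using A sum.not_neutral_contains_not_neutral by force
  then have ne: "set_pmf (proportional_pmf S w) \<inter> A \<noteq> {}"
    using pos by (auto simp: set_pmf_iff pmf_S split: if_splits)
  have supp: "set_pmf (proportional_pmf S w) \<subseteq> S"
    by (auto simp: set_pmf_iff pmf_S split: if_splits)
  have "measure (proportional_pmf S w) A = measure (proportional_pmf S w) (S \<inter> A)"
    using supp by (intro measure_pmf.finite_measure_eq_AE) (auto simp: AE_measure_pmf_iff)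
  also have "\<dots> = sum w (S \<inter> A) / sum w S"
    using S(1) by (simp add: measure_measure_pmf_finite pmf_S sum_divide_distrib)
  finally have "measure (proportional_pmf S w) A = sum w (S \<inter> A) / sum w S" .
  moreover have "pmf (proportional_pmf (S \<inter> A) w) x
      = (if x \<in> S \<inter> A then w x / sum w (S \<inter> A) else 0)"
    using S A by (intro pmf_proportional_pmf) auto
  ultimately show "pmf (cond_pmf (proportional_pmf S w) A) x = pmf (proportional_pmf (S \<inter> A) w) x"
    using pos by (simp add: pmf_cond[OF ne] pmf_S)
qed

lemma proportional_pmf_cong:
  assumes "\<And>s. s \<in> S \<Longrightarrow> w s = v s"
  shows "proportional_pmf S w = proportional_pmf S v"
proof -
  have "(\<lambda>x. if x \<in> S then w x / sum w S else 0) = (\<lambda>x. if x \<in> S then v x / sum v S else 0)"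
    using assms by (auto simp: fun_eq_iff cong: sum.cong)
  then show ?thesis
    unfolding proportional_pmf_def by simp
qed

lemma proportional_pmf_scale:
  assumes "c \<noteq> 0"
  shows "proportional_pmf S (\<lambda>s. c * w s) = proportional_pmf S w"
  using assms by (simp add: proportional_pmf_def flip: sum_distrib_left cong: if_cong)

text \<open>Lets a given distribution, such as a product of Bernoulli distributions, enter the calculus of
  weights.\<close>

lemma proportional_pmf_pmf:
  assumes "finite S" "set_pmf M \<subseteq> S"
  shows "proportional_pmf S (pmf M) = M"
proof (rule pmf_eqI)
  fix x
  have one: "sum (pmf M) S = 1"
    using assms by (rule sum_pmf_eq_1)
  have "pmf (proportional_pmf S (pmf M)) x = (if x \<in> S then pmf M x / sum (pmf M) S else 0)"
    using assms(1) one by (intro pmf_proportional_pmf) auto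
  then show "pmf (proportional_pmf S (pmf M)) x = pmf M x"
    using assms(2) one by (auto simp: pmf_eq_0_set_pmf)
qed

lemma proportional_pmf_of_bool:
  assumes "finite S" "\<exists>s\<in>S. Q s"
  shows "proportional_pmf S (\<lambda>s. of_bool (Q s)) = pmf_of_set {s \<in> S. Q s}"
proof (rule pmf_eqI)
  fix x
  have card: "(\<Sum>s\<in>S. of_bool (Q s)) = real (card {s \<in> S. Q s})"
    using assms(1) by (simp add: of_bool_def Collect_conj_eq Int_commute flip: sum.inter_filter)
  have ne: "{s \<in> S. Q s} \<noteq> {}" using assms(2) by auto
  have pos: "0 < real (card {s \<in> S. Q s})"
    using assms(1) ne by (simp add: card_gt_0_iff)
  have "pmf (proportional_pmf S (\<lambda>s. of_bool (Q s))) x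
      = (if x \<in> S then of_bool (Q x) / (\<Sum>s\<in>S. of_bool (Q s)) else 0)"
    using assms(1) pos by (intro pmf_proportional_pmf) (auto simp: card)
  then show "pmf (proportional_pmf S (\<lambda>s. of_bool (Q s))) x = pmf (pmf_of_set {s \<in> S. Q s}) x"
    using assms(1) ne by (auto simp: card indicator_def)
qed

lemma pair_proportional_pmf:
  assumes S: "finite S" "\<And>s. s \<in> S \<Longrightarrow> 0 \<le> v s" "0 < sum v S"
    and T: "finite T" "\<And>t. t \<in> T \<Longrightarrow> 0 \<le> w t" "0 < sum w T"
  shows "pair_pmf (proportional_pmf S v) (proportional_pmf T w)
       = proportional_pmf (S \<times> T) (\<lambda>(s, t). v s * w t)"
proof (rule pmf_eqI)
  fix x :: "'a \<times> 'b"
  obtain s t where x: "x = (s, t)" by force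
  have total: "(\<Sum>(s, t)\<in>S \<times> T. v s * w t) = sum v S * sum w T"
    by (simp add: sum_product sum.cartesian_product)
  have "pmf (proportional_pmf (S \<times> T) (\<lambda>(s, t). v s * w t)) x
     = (if x \<in> S \<times> T then (case x of (s, t) \<Rightarrow> v s * w t) / (\<Sum>(s, t)\<in>S \<times> T. v s * w t) else 0)"
    using S T by (intro pmf_proportional_pmf) (auto simp: total)
  then show "pmf (pair_pmf (proportional_pmf S v) (proportional_pmf T w)) x
      = pmf (proportional_pmf (S \<times> T) (\<lambda>(s, t). v s * w t)) x"
    by (simp add: x pmf_pair total pmf_proportional_pmf[OF S] pmf_proportional_pmf[OF T])
qed

lemma sum_fst_fibre:
  assumes "a \<in> A"
  shows "(\<Sum>s\<in>{s \<in> A \<times> B. fst s = a}. w s) = (\<Sum>b\<in>B. w (a, b))"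
  using assms by (intro sum.reindex_bij_witness[of _ "Pair a" snd]) auto

lemma sum_snd_fibre:
  assumes "b \<in> B"
  shows "(\<Sum>s\<in>{s \<in> A \<times> B. snd s = b}. w s) = (\<Sum>a\<in>A. w (a, b))"
  using assms by (intro sum.reindex_bij_witness[of _ "\<lambda>a. (a, b)" fst]) auto

text \<open>The normalisation of the joint weight cancels, so that conditioning on one coordinate only freezes
  that argument of the weight.\<close>

lemma proportional_pmf_given_fst:
  assumes fin: "finite A" "finite B" and w: "\<And>s. s \<in> A \<times> B \<Longrightarrow> 0 \<le> w s"
    and a: "a \<in> A" and pos: "0 < (\<Sum>b\<in>B. w (a, b))"
  shows "map_pmf snd (cond_pmf (proportional_pmf (A \<times> B) w) {s. fst s = a})
       = proportional_pmf B (\<lambda>b. w (a, b))"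
proof -
  have slice: "A \<times> B \<inter> {s. fst s = a} = {a} \<times> B" using a by auto
  have sum_slice: "sum w ({a} \<times> B) = (\<Sum>b\<in>B. w (a, b))"
    by (intro sum.reindex_bij_witness[of _ "Pair a" snd]) auto
  have "cond_pmf (proportional_pmf (A \<times> B) w) {s. fst s = a} = proportional_pmf ({a} \<times> B) w"
    using cond_proportional_pmf[of "A \<times> B" w "{s. fst s = a}"] fin w pos
    unfolding slice sum_slice by blast
  also have "map_pmf snd \<dots> = proportional_pmf B (\<lambda>b. w (a, b))"
    using fin w a pos
    by (intro map_proportional_pmf[where c = 1]) (auto simp: sum_snd_fibre sum_slice)
  finally show ?thesis .
qed

lemma proportional_pmf_given_snd:
  assumes fin: "finite A" "finite B" and w: "\<And>s. s \<in> A \<times> B \<Longrightarrow> 0 \<le> w s"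
    and b: "b \<in> B" and pos: "0 < (\<Sum>a\<in>A. w (a, b))"
  shows "map_pmf fst (cond_pmf (proportional_pmf (A \<times> B) w) {s. snd s = b})
       = proportional_pmf A (\<lambda>a. w (a, b))"
proof -
  have slice: "A \<times> B \<inter> {s. snd s = b} = A \<times> {b}" using b by auto
  have sum_slice: "sum w (A \<times> {b}) = (\<Sum>a\<in>A. w (a, b))"
    by (intro sum.reindex_bij_witness[of _ "\<lambda>a. (a, b)" fst]) auto
  have "cond_pmf (proportional_pmf (A \<times> B) w) {s. snd s = b} = proportional_pmf (A \<times> {b}) w"
    using cond_proportional_pmf[of "A \<times> B" w "{s. snd s = b}"] fin w pos
    unfolding slice sum_slice by blast
  also have "map_pmf fst \<dots> = proportional_pmf A (\<lambda>a. w (a, b))"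
    using fin w b pos
    by (intro map_proportional_pmf[where c = 1]) (auto simp: sum_fst_fibre sum_slice)
  finally show ?thesis .
qed


section \<open>Percolation subcomplexes and cochains\<close>

lemma finite_cells_of_dim:
  "finite_cell_complex X \<Longrightarrow> finite (cells_of_dim X j)"
  by (simp add: finite_cell_complex_def cells_of_dim_def)

lemma skeleton_Un_eq:
  "skeleton X (int j) = skeleton X (int j - 1) \<union> cells_of_dim X j"
  by (auto simp: skeleton_def cells_of_dim_def)

lemma skeleton_Int_cells_of_dim:
  "skeleton X (int j - 1) \<inter> cells_of_dim X j = {}"
  by (auto simp: skeleton_def cells_of_dim_def)

text \<open>The boundary of a cell of dimension at most \<open>j\<close> lies in cells of dimension at most \<open>j - 1\<close>, all of
  which are in \<open>P\<close>. Hence a percolation subcomplex is an unconstrained choice of \<open>j\<close>-cells, which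
  is what makes sums over subcomplexes factorise over cells.\<close>

lemma subcomplex_between_skeleta:
  assumes X: "finite_cell_complex X"
    and P: "skeleton X (int j - 1) \<subseteq> P" "P \<subseteq> skeleton X (int j)"
  shows "subcomplex X P"
  unfolding subcomplex_def
proof (intro conjI ballI)
  show "P \<subseteq> cells X" using P(2) by (auto simp: skeleton_def)
  fix c assume c: "c \<in> P"
  then have c': "c \<in> cells X" "cell_dim X c \<le> j" using P(2) by (auto simp: skeleton_def)
  have "char_map X c ` disk_sphere (cell_dim X c)
      \<subseteq> realization X {d \<in> cells X. cell_dim X d < cell_dim X c}"
    using X c' by (simp add: finite_cell_complex_def)
  also have "\<dots> \<subseteq> realization X P"
    using P(1) c'(2) by (fastforce simp: realization_def skeleton_def)
  finally have "char_map X c ` disk_sphere (cell_dim X c) \<subseteq> realization X P" .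
  moreover have "char_map X c ` open_disk (cell_dim X c) \<subseteq> realization X P"
    using c by (auto simp: realization_def open_cell_def)
  moreover have "closed_disk n \<subseteq> disk_sphere n \<union> open_disk n" for n
    by (auto simp: disk_sphere_def)
  ultimately show "char_map X c ` closed_disk (cell_dim X c) \<subseteq> realization X P"
    by blast
qed

lemma percolation_subcomplexes_eq:
  assumes "finite_cell_complex X"
  shows "percolation_subcomplexes X j
       = {P. skeleton X (int j - 1) \<subseteq> P \<and> P \<subseteq> skeleton X (int j)}"
  using subcomplex_between_skeleta[OF assms] by (auto simp: percolation_subcomplexes_def)

lemma finite_percolation_subcomplexes:
  assumes "finite_cell_complex X"
  shows "finite (percolation_subcomplexes X j)"
proof (rule finite_subset)
  show "percolation_subcomplexes X j \<subseteq> Pow (cells X)"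
    by (auto simp: percolation_subcomplexes_def skeleton_def)
  show "finite (Pow (cells X))"
    using assms by (simp add: finite_cell_complex_def)
qed

lemma sum_percolation_subcomplexes:
  assumes "finite_cell_complex X"
  shows "(\<Sum>P\<in>percolation_subcomplexes X j. F (P \<inter> cells_of_dim X j))
       = (\<Sum>B\<in>Pow (cells_of_dim X j). F B)"
  using skeleton_Int_cells_of_dim[of X j]
  by (intro sum.reindex_bij_witness[of _ "\<lambda>B. skeleton X (int j - 1) \<union> B" "\<lambda>P. P \<inter> cells_of_dim X j"])
     (auto simp: percolation_subcomplexes_eq[OF assms] skeleton_Un_eq)

lemma finite_cochains:
  assumes "finite_cell_complex X"
  shows "finite (cochains X q j)"
proof (rule finite_subset)
  let ?O = "oriented_cells X j"
  show "cochains X q j \<subseteq> {f. \<forall>x. (x \<in> ?O \<longrightarrow> f x \<in> {0..<q}) \<and> (x \<notin> ?O \<longrightarrow> f x = 0)}"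
    by (auto simp: cochains_def)
  have "(UNIV :: orientation set) = {Pos, Neg}"
    using orientation.exhaust by auto
  then have "finite (UNIV :: orientation set)" by (metis finite.emptyI finite_insert)
  then have "finite ?O"
    using finite_cells_of_dim[OF assms] by (simp add: oriented_cells_def)
  then show "finite {f. \<forall>x. (x \<in> ?O \<longrightarrow> f x \<in> {0..<q}) \<and> (x \<notin> ?O \<longrightarrow> f x = 0)}"
    by (rule finite_set_of_finite_funs) simp
qed

lemma zero_in_cochains: "0 < q \<Longrightarrow> (\<lambda>_. 0) \<in> cochains X q j"
  by (simp add: cochains_def)

lemma cochain_mod:
  assumes "0 < q" "f \<in> cochains X q j"
  shows "f x mod q = f x"
proof (cases "x \<in> oriented_cells X j")
  case True
  then have "f x \<in> {0..<q}" using assms(2) unfolding cochains_def by blast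
  then show ?thesis by simp
next
  case False
  then have "f x = 0" using assms(2) unfolding cochains_def by blast
  then show ?thesis by simp
qed

lemma cochain_eq_zero:
  assumes f: "f \<in> cochains X q j" and zero: "\<And>c. c \<in> cells_of_dim X j \<Longrightarrow> f (c, Pos) = 0"
  shows "f = (\<lambda>_. 0)"
proof
  fix x
  show "f x = 0"
  proof (cases "x \<in> oriented_cells X j")
    case False
    then show ?thesis using f unfolding cochains_def by blast
  next
    case True
    obtain c s where x: "x = (c, s)" by force
    with True have c: "c \<in> cells_of_dim X j" "(c, Pos) \<in> oriented_cells X j"
      by (auto simp: oriented_cells_def)
    then have "f (reverse_cell (c, Pos)) = (- f (c, Pos)) mod q"
      using f unfolding cochains_def by blast
    then have "f (c, Neg) = 0" using zero[OF c(1)] by simp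
    then show ?thesis using zero[OF c(1)] x by (cases s) auto
  qed
qed

text \<open>A relative \<open>(i - 1)\<close>-cochain vanishes on the cells of \<open>P1\<close>, which include all \<open>(i - 1)\<close>-cells, so it
  is zero.\<close>

lemma relative_coboundaries_trivial:
  assumes q: "0 < q" and P1: "skeleton X (int i - 1) \<subseteq> P1"
  shows "relative_coboundaries X q i P2 P1 = {\<lambda>_. 0}"
proof (cases i)
  case 0
  then show ?thesis by (simp add: relative_coboundaries_def)
next
  case (Suc k)
  have "cells_of_dim X k \<subseteq> P1"
    using P1 Suc by (auto simp: cells_of_dim_def skeleton_def)
  then have "relative_cochains X q k P2 P1 = {\<lambda>_. 0}"
    using zero_in_cochains[OF q, of X k]
    by (auto simp: relative_cochains_def intro!: cochain_eq_zero)
  then show ?thesis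
    unfolding relative_coboundaries_def Suc nat.case
    by (simp add: coboundary_def eval_chain_def cong: if_cong)
qed

text \<open>Each coset of the trivial group of coboundaries is a singleton, so cocycles and cohomology classes
  correspond one to one.\<close>

lemma order_relative_cohomology:
  assumes q: "0 < q" and P1: "skeleton X (int i - 1) \<subseteq> P1"
  shows "Coset.order (relative_cohomology X q i P2 P1) = card (relative_cocycles X q i P2 P1)"
proof -
  have coset: "{\<lambda>_. 0} #>\<^bsub>cocycle_group X q i P2 P1\<^esub> f = {f}" if "f \<in> relative_cocycles X q i P2 P1" for f
  proof -
    have "f \<in> cochains X q i"
      using that by (simp add: relative_cocycles_def relative_cochains_def)
    then have "(\<lambda>x. f x mod q) = f"
      using cochain_mod[OF q] by blast
    then show ?thesis by (simp add: r_coset_def cocycle_group_def)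
  qed
  have "carrier (relative_cohomology X q i P2 P1) = (\<lambda>f. {f}) ` relative_cocycles X q i P2 P1"
    using coset
    by (auto simp: relative_cohomology_def relative_coboundaries_trivial[OF q P1] FactGroup_def
        RCOSETS_def cocycle_group_def)
  then show ?thesis
    by (simp add: Coset.order_def card_image)
qed


section \<open>Weights of percolation subcomplexes\<close>

text \<open>The part of the joint weight that comes from one dimension: \<open>J\<close> stands for the cells of that
  dimension and \<open>a\<close> for \<open>f\<close> or its coboundary, so that the two dimensions can be treated alike.\<close>

definition cell_weight :: "real \<Rightarrow> 'c set \<Rightarrow> ('c \<Rightarrow> int) \<Rightarrow> 'c set \<Rightarrow> real" where
  "cell_weight k J a P =
     (\<Prod>c\<in>J. I0 (cell_state P c) + k * of_int (cell_state P c) * I0 (a c))"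

lemma cell_weight_eq:
  assumes "finite J"
  shows "cell_weight k J a P = k ^ card (P \<inter> J) * of_bool (\<forall>c\<in>P \<inter> J. a c = 0)"
proof -
  have "cell_weight k J a P = (\<Prod>c\<in>J. if c \<in> P then k * I0 (a c) else 1)"
    unfolding cell_weight_def by (intro prod.cong) (auto simp: cell_state_def I0_def)
  also have "\<dots> = (\<Prod>c\<in>J \<inter> P. k * I0 (a c))"
    using assms by (simp add: prod.inter_restrict)
  also have "\<dots> = k ^ card (P \<inter> J) * (\<Prod>c\<in>P \<inter> J. I0 (a c))"
    by (simp add: prod.distrib Int_commute)
  also have "(\<Prod>c\<in>P \<inter> J. I0 (a c)) = of_bool (\<forall>c\<in>P \<inter> J. a c = 0)"
    using assms by (auto simp: I0_def indicator_def prod_zero_iff)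
  finally show ?thesis .
qed

lemma cell_weight_nonneg: "0 \<le> k \<Longrightarrow> 0 \<le> cell_weight k J a P"
  unfolding cell_weight_def by (intro prod_nonneg) (auto simp: cell_state_def I0_def)

text \<open>Expanding the product on the right chooses, for each cell, the term \<open>k * I0 (a c)\<close> (open) or \<open>1\<close>
  (closed).\<close>

lemma sum_cell_weight:
  assumes X: "finite_cell_complex X"
  shows "(\<Sum>P\<in>percolation_subcomplexes X j. cell_weight k (cells_of_dim X j) a P)
       = (\<Prod>c\<in>cells_of_dim X j. 1 + k * I0 (a c))"
proof -
  let ?J = "cells_of_dim X j"
  have J: "finite ?J" by (rule finite_cells_of_dim[OF X])
  have local: "cell_weight k ?J a P = cell_weight k ?J a (P \<inter> ?J)" for P
    unfolding cell_weight_def by (intro prod.cong) (auto simp: cell_state_def)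
  have "(\<Sum>P\<in>percolation_subcomplexes X j. cell_weight k ?J a P)
      = (\<Sum>P\<in>percolation_subcomplexes X j. cell_weight k ?J a (P \<inter> ?J))"
    by (rule sum.cong[OF refl local])
  also have "\<dots> = (\<Sum>B\<in>Pow ?J. cell_weight k ?J a B)"
    by (rule sum_percolation_subcomplexes[OF X])
  also have "\<dots> = (\<Sum>B\<in>Pow ?J. (\<Prod>c\<in>B. k * I0 (a c)) * (\<Prod>c\<in>?J - B. 1))"
  proof (rule sum.cong[OF refl])
    fix B assume "B \<in> Pow ?J"
    then have "?J \<inter> B = B" by auto
    moreover have "cell_weight k ?J a B = (\<Prod>c\<in>?J. if c \<in> B then k * I0 (a c) else 1)"
      unfolding cell_weight_def by (intro prod.cong) (auto simp: cell_state_def I0_def)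
    ultimately show "cell_weight k ?J a B = (\<Prod>c\<in>B. k * I0 (a c)) * (\<Prod>c\<in>?J - B. 1)"
      using J by (simp flip: prod.inter_restrict)
  qed
  also have "\<dots> = (\<Prod>c\<in>?J. k * I0 (a c) + 1)"
    by (rule prod_add[OF J, symmetric])
  finally show ?thesis by (simp add: add.commute)
qed

lemma sum_cell_weight_pos:
  assumes "finite_cell_complex X" "0 \<le> k"
  shows "0 < (\<Sum>P\<in>percolation_subcomplexes X j. cell_weight k (cells_of_dim X j) a P)"
  unfolding sum_cell_weight[OF assms(1)] using assms(2)
  by (intro prod_pos) (simp add: I0_def add_pos_nonneg)

text \<open>The Fortuin--Kasteleyn identity \<open>exp (\<beta> * I) = 1 + (exp \<beta> - 1) * I\<close> for \<open>I\<close> equal to \<open>0\<close> or \<open>1\<close>,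
  applied to each cell.\<close>

lemma sum_cell_weight_exp:
  assumes X: "finite_cell_complex X"
  shows "(\<Sum>P\<in>percolation_subcomplexes X j. cell_weight (exp \<beta> - 1) (cells_of_dim X j) a P)
       = exp (\<beta> * (\<Sum>c\<in>cells_of_dim X j. I0 (a c)))"
proof -
  have "1 + (exp \<beta> - 1) * I0 y = exp (\<beta> * I0 y)" for y
    by (simp add: I0_def indicator_def)
  then show ?thesis
    using finite_cells_of_dim[OF X]
    by (simp add: sum_cell_weight[OF X] sum_distrib_left exp_sum)
qed

lemma bernoulli_weight:
  fixes p :: real
  assumes "p < 1" "m \<le> n"
  shows "p ^ m * (1 - p) ^ (n - m) = (1 - p) ^ n * (p / (1 - p)) ^ m"
  using assms by (simp add: power_diff power_divide)

text \<open>A configuration with \<open>m\<close> open cells among the satisfied ones has probability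
  \<open>p ^ m * (1 - p) ^ (card S - m)\<close>, which is \<open>(p / (1 - p)) ^ m\<close> up to a factor that does not depend on the
  configuration; a subcomplex with an unsatisfied open cell has zero weight and is never produced.\<close>

lemma independent_percolation_eq:
  assumes X: "finite_cell_complex X" and p: "0 \<le> p" "p < 1"
  shows "independent_percolation X j p {c \<in> cells_of_dim X j. a c = 0}
       = proportional_pmf (percolation_subcomplexes X j)
           (cell_weight (p / (1 - p)) (cells_of_dim X j) a)"
proof -
  let ?J = "cells_of_dim X j" and ?K = "skeleton X (int j - 1)"
  define S where "S = {c \<in> ?J. a c = 0}"
  define M where "M = Pi_pmf S False (\<lambda>_. bernoulli_pmf p)"
  define Om where "Om = PiE_dflt S False (\<lambda>_. UNIV :: bool set)"
  let ?g = "\<lambda>\<omega>. ?K \<union> {c \<in> S. \<omega> c}"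
  have J: "finite ?J" by (rule finite_cells_of_dim[OF X])
  have S: "finite S" "S \<subseteq> ?J" using J by (auto simp: S_def)
  have Om: "finite Om" using S(1) by (auto simp: Om_def)
  have supp: "set_pmf M \<subseteq> Om"
    using set_Pi_pmf_subset'[OF S(1)] by (fastforce simp: M_def Om_def PiE_dflt_def)
  have disj: "?K \<inter> ?J = {}" by (rule skeleton_Int_cells_of_dim)
  have pmf_M: "pmf M \<omega> = (1 - p) ^ card S * (p / (1 - p)) ^ card {c \<in> S. \<omega> c}" if "\<omega> \<in> Om" for \<omega>
  proof -
    have "pmf M \<omega> = (\<Prod>c\<in>S. if \<omega> c then p else 1 - p)"
      using that S(1) p unfolding M_def
      by (subst pmf_Pi') (auto simp: Om_def PiE_dflt_def intro!: prod.cong)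
    also have "\<dots> = p ^ card {c \<in> S. \<omega> c} * (1 - p) ^ card {c \<in> S. \<not> \<omega> c}"
      using S(1) by (simp add: prod.If_cases Int_def)
    also have "{c \<in> S. \<not> \<omega> c} = S - {c \<in> S. \<omega> c}" by auto
    also have "card \<dots> = card S - card {c \<in> S. \<omega> c}"
      using S(1) by (intro card_Diff_subset) auto
    finally show ?thesis
      using p S(1) by (simp add: bernoulli_weight card_mono)
  qed
  have "map_pmf ?g (proportional_pmf Om (pmf M))
      = proportional_pmf (percolation_subcomplexes X j) (cell_weight (p / (1 - p)) ?J a)"
  proof (rule map_proportional_pmf[where c = "(1 - p) ^ card S"])
    show "0 < sum (pmf M) Om" using sum_pmf_eq_1[OF Om supp] by simp
    show "?g ` Om \<subseteq> percolation_subcomplexes X j"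
      using S(2) by (auto simp: percolation_subcomplexes_eq[OF X] skeleton_Un_eq)
    fix P assume P: "P \<in> percolation_subcomplexes X j"
    then have P': "P = ?K \<union> (P \<inter> ?J)"
      by (auto simp: percolation_subcomplexes_eq[OF X] skeleton_Un_eq)
    show "(\<Sum>\<omega>\<in>{\<omega> \<in> Om. ?g \<omega> = P}. pmf M \<omega>)
        = (1 - p) ^ card S * cell_weight (p / (1 - p)) ?J a P"
    proof (cases "P \<inter> ?J \<subseteq> S")
      case True
      \<comment> \<open>The fibre over \<open>P\<close> is a single configuration, since \<open>P\<close> determines which cells are open.\<close>
      let ?\<omega> = "\<lambda>c. c \<in> P \<inter> ?J"
      have conf: "{c \<in> S. ?\<omega> c} = P \<inter> ?J" using True by auto
      have "{\<omega> \<in> Om. ?g \<omega> = P} = {?\<omega>}"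
      proof (intro equalityI subsetI)
        fix \<omega> assume \<omega>: "\<omega> \<in> {\<omega> \<in> Om. ?g \<omega> = P}"
        have "\<omega> c = (c \<in> P \<inter> ?J)" for c
          using \<omega> disj S(2) by (auto simp: Om_def PiE_dflt_def)
        then show "\<omega> \<in> {?\<omega>}" by auto
      next
        fix \<omega> assume "\<omega> \<in> {?\<omega>}"
        then show "\<omega> \<in> {\<omega> \<in> Om. ?g \<omega> = P}"
          using True conf P' by (auto simp: Om_def PiE_dflt_def)
      qed
      moreover have "?\<omega> \<in> Om" using True by (auto simp: Om_def PiE_dflt_def)
      moreover have "\<forall>c\<in>P \<inter> ?J. a c = 0" using True by (auto simp: S_def)
      ultimately show ?thesis
        using pmf_M[of ?\<omega>] unfolding conf by (simp add: cell_weight_eq[OF J])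
    next
      case False
      then have fibre_empty: "{\<omega> \<in> Om. ?g \<omega> = P} = {}" using disj by auto
      have "\<not> (\<forall>c\<in>P \<inter> ?J. a c = 0)" using False by (auto simp: S_def)
      then show ?thesis unfolding fibre_empty cell_weight_eq[OF J] by simp
    qed
  qed (use Om p finite_percolation_subcomplexes[OF X] in auto)
  then have "map_pmf ?g M
      = proportional_pmf (percolation_subcomplexes X j) (cell_weight (p / (1 - p)) ?J a)"
    by (simp only: proportional_pmf_pmf[OF Om supp])
  then show ?thesis
    unfolding independent_percolation_def M_def S_def .
qed


section \<open>The coupling\<close>

text \<open>The joint weight with the subcomplexes fixed: the satisfaction of all open cells in both
  dimensions is exactly the relative cocycle condition.\<close>

lemma cell_weights_relative_cocycles:
  assumes X: "finite_cell_complex X"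
    and P2: "P2 \<in> percolation_subcomplexes X (i + 1)" and f: "f \<in> cochains X q i"
  shows "cell_weight k1 (cells_of_dim X i) (\<lambda>\<epsilon>. f (\<epsilon>, Pos)) P1
       * cell_weight k2 (cells_of_dim X (i + 1)) (\<lambda>\<sigma>. coboundary X q i f (\<sigma>, Pos)) P2
       = k1 ^ num_cells X i P1 * k2 ^ num_cells X (i + 1) P2
         * of_bool (f \<in> relative_cocycles X q i P2 P1)"
  using f unfolding cell_weight_eq[OF finite_cells_of_dim[OF X]] relative_cocycles_percolation[OF P2]
  by (auto simp: num_cells_def)


theorem theorem5:
  fixes X :: "('a, 'c) cell_complex"
    and q :: int and i :: nat
    and \<beta>2 \<beta>1 p2 p1 k2 k1 :: real
    and \<kappa> :: "('c cochain \<times> 'c set \<times> 'c set) pmf"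
  assumes "finite_cell_complex X"
    and "prime q"
    and "\<beta>2 \<ge> 0" and "\<beta>1 \<ge> 0"
    and "p2 = 1 - exp (- \<beta>2)" and "p1 = 1 - exp (- \<beta>1)"
    and "k2 = p2 / (1 - p2)" and "k1 = p1 / (1 - p1)"
    and "\<kappa> = higgs_coupling k2 k1 q i X"
  shows
    "map_pmf (\<lambda>(f, P2, P1). f) \<kappa> = potts_lattice_higgs \<beta>2 \<beta>1 q i X \<and>
     map_pmf (\<lambda>(f, P2, P1). (P2, P1)) \<kappa> = coupled_plaquette_percolation p2 p1 q i X \<and>
     (\<forall>f\<in>cochains X q i.
        map_pmf (\<lambda>(f, P2, P1). (P2, P1)) (cond_pmf \<kappa> {(g, P2, P1). g = f}) =
        pair_pmf
          (independent_percolation X (i + 1) p2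
             {\<sigma> \<in> cells_of_dim X (i + 1). coboundary X q i f (\<sigma>, Pos) = 0})
          (independent_percolation X i p1
             {\<epsilon> \<in> cells_of_dim X i. f (\<epsilon>, Pos) = 0})) \<and>
     (\<forall>(P2, P1) \<in> set_pmf (map_pmf (\<lambda>(f, P2, P1). (P2, P1)) \<kappa>).
        map_pmf (\<lambda>(f, P2, P1). f) (cond_pmf \<kappa> {(f, Q2, Q1). Q2 = P2 \<and> Q1 = P1}) =
        pmf_of_set (relative_cocycles X q i P2 P1))"
proof -
  note X = assms(1)
  have q: "0 < q" using assms(2) by (simp add: prime_gt_0_int)
  have p: "0 \<le> p2" "p2 < 1" "0 \<le> p1" "p1 < 1"
    using assms(3-6) by auto
  have k: "k2 = exp \<beta>2 - 1" "k1 = exp \<beta>1 - 1"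
    by (simp_all add: assms(5-8) exp_minus field_simps)
  have k0: "0 \<le> k2" "0 \<le> k1" using assms(3,4) by (simp_all add: k)
  define C where "C = cochains X q i"
  define B where "B = percolation_subcomplexes X (i + 1) \<times> percolation_subcomplexes X i"
  define W2 where "W2 f = cell_weight k2 (cells_of_dim X (i + 1)) (\<lambda>\<sigma>. coboundary X q i f (\<sigma>, Pos))" for f
  define W1 where "W1 f = cell_weight k1 (cells_of_dim X i) (\<lambda>\<epsilon>. f (\<epsilon>, Pos))" for f :: "'c cochain"
  define w where "w = (\<lambda>(f, P2, P1). W1 f P1 * W2 f P2)"
  define Z where "Z = (\<lambda>(P2, P1). relative_cocycles X q i P2 P1)"
  define K where "K = (\<lambda>(P2, P1). k1 ^ num_cells X i P1 * k2 ^ num_cells X (i + 1) P2)"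
  have \<kappa>: "\<kappa> = proportional_pmf (C \<times> B) w"
    unfolding assms(9) higgs_coupling_def C_def B_def w_def W1_def W2_def cell_weight_def ..
  have C: "finite C" unfolding C_def by (rule finite_cochains[OF X])
  have B: "finite B" unfolding B_def by (simp add: finite_percolation_subcomplexes[OF X])
  have W: "0 \<le> W1 f P" "0 \<le> W2 f P" for f P
    using k0 by (simp_all add: W1_def W2_def cell_weight_nonneg)
  have w: "0 \<le> w s" for s
    by (auto simp: w_def W split: prod.split)
  have w_cocycle: "w (f, b) = K b * of_bool (f \<in> Z b)" if "f \<in> C" "b \<in> B" for f b
    using that cell_weights_relative_cocycles[OF X]
    by (auto simp: w_def W1_def W2_def Z_def K_def B_def C_def)
  have sum_B: "(\<Sum>b\<in>B. w (f, b)) = (\<Sum>P\<in>percolation_subcomplexes X (i + 1). W2 f P)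
      * (\<Sum>P\<in>percolation_subcomplexes X i. W1 f P)" for f
    by (simp add: B_def w_def sum_product sum.cartesian_product split_def mult.commute[of "W1 _ _"])
  have gibbs: "(\<Sum>b\<in>B. w (f, b)) = exp (- higgs_hamiltonian \<beta>2 \<beta>1 q i X f)" for f
    unfolding sum_B W1_def W2_def k sum_cell_weight_exp[OF X] higgs_hamiltonian_def
    by (simp flip: exp_add)
  \<comment> \<open>Each cochain contributes its Gibbs weight, which is positive, and there is at least one
    cochain.\<close>
  have pos: "0 < sum w (C \<times> B)"
  proof -
    have "(\<lambda>_. 0) \<in> C" unfolding C_def by (rule zero_in_cochains[OF q])
    then have "0 < (\<Sum>f\<in>C. \<Sum>b\<in>B. w (f, b))"
      unfolding gibbs using C by (intro sum_pos) auto
    then show ?thesis by (simp add: sum.cartesian_product)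
  qed

  have 1: "map_pmf fst \<kappa> = potts_lattice_higgs \<beta>2 \<beta>1 q i X"
    unfolding \<kappa> potts_lattice_higgs_def C_def[symmetric]
    using C B w pos
    by (intro map_proportional_pmf[where c = 1]) (auto simp: sum_fst_fibre gibbs)

  have 2: "map_pmf snd \<kappa> = coupled_plaquette_percolation p2 p1 q i X"
  proof -
    let ?n2 = "card (cells_of_dim X (i + 1))" and ?n1 = "card (cells_of_dim X i)"
    \<comment> \<open>The factor that turns powers of \<open>k = p / (1 - p)\<close> into Bernoulli weights.\<close>
    define c where "c = (1 - p2) ^ ?n2 * (1 - p1) ^ ?n1"
    have c: "0 < c" using p by (simp add: c_def)
    let ?v = "\<lambda>b. K b * real (card (Z b))"
    have "map_pmf snd \<kappa> = proportional_pmf B ?v"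
      unfolding \<kappa>
    proof (rule map_proportional_pmf[where c = 1])
      fix b assume b: "b \<in> B"
      then have "Z b \<subseteq> C"
        by (auto simp: B_def C_def Z_def relative_cocycles_def relative_cochains_def)
      then have "(\<Sum>f\<in>C. of_bool (f \<in> Z b)) = real (card (Z b))"
        using C by (simp add: Int_absorb1)
      then have "(\<Sum>f\<in>C. w (f, b)) = ?v b"
        using b by (simp add: w_cocycle flip: sum_distrib_left)
      then show "(\<Sum>s\<in>{s \<in> C \<times> B. snd s = b}. w s) = 1 * ?v b"
        using b by (simp add: sum_snd_fibre)
    qed (use C B w pos in auto)
    also have "\<dots> = proportional_pmf B (\<lambda>b. c * ?v b)"
      using c by (subst proportional_pmf_scale) auto
    also have "\<dots> = coupled_plaquette_percolation p2 p1 q i X"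
      unfolding coupled_plaquette_percolation_def B_def[symmetric]
    proof (rule proportional_pmf_cong, clarify)
      fix P2 P1 assume b: "(P2, P1) \<in> B"
      then have "skeleton X (int i - 1) \<subseteq> P1"
        by (simp add: B_def percolation_subcomplexes_def)
      note order = order_relative_cohomology[OF q this, of P2]
      have le: "num_cells X j P \<le> card (cells_of_dim X j)" for j P
        unfolding num_cells_def by (intro card_mono finite_cells_of_dim[OF X]) auto
      show "c * ?v (P2, P1) =
          p2 ^ num_cells X (i + 1) P2 * (1 - p2) ^ (?n2 - num_cells X (i + 1) P2)
          * p1 ^ num_cells X i P1 * (1 - p1) ^ (?n1 - num_cells X i P1)
          * real (Coset.order (relative_cohomology X q i P2 P1))"
        using bernoulli_weight[OF p(2) le, of "i + 1" P2] bernoulli_weight[OF p(4) le, of i P1]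
        by (simp add: c_def K_def Z_def order assms(7,8) mult_ac del: Suc_eq_plus1)
    qed
    finally show ?thesis .
  qed

  have 3: "map_pmf snd (cond_pmf \<kappa> {s. fst s = f}) =
        pair_pmf
          (independent_percolation X (i + 1) p2
             {\<sigma> \<in> cells_of_dim X (i + 1). coboundary X q i f (\<sigma>, Pos) = 0})
          (independent_percolation X i p1 {\<epsilon> \<in> cells_of_dim X i. f (\<epsilon>, Pos) = 0})"
    if f: "f \<in> cochains X q i" for f
  proof -
    have "map_pmf snd (cond_pmf \<kappa> {s. fst s = f}) = proportional_pmf B (\<lambda>b. w (f, b))"
      unfolding \<kappa> using f
      by (intro proportional_pmf_given_fst C B w) (simp_all add: C_def gibbs)
    also have "(\<lambda>b. w (f, b)) = (\<lambda>(P2, P1). W2 f P2 * W1 f P1)"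
      by (auto simp: w_def)
    also have "proportional_pmf B \<dots> =
        pair_pmf (proportional_pmf (percolation_subcomplexes X (i + 1)) (W2 f))
          (proportional_pmf (percolation_subcomplexes X i) (W1 f))"
      unfolding B_def
      by (intro pair_proportional_pmf[symmetric] finite_percolation_subcomplexes[OF X] W)
        (simp_all only: W1_def W2_def sum_cell_weight_pos[OF X] k0)
    finally show ?thesis
      using independent_percolation_eq[OF X p(1,2), of "i + 1" "\<lambda>\<sigma>. coboundary X q i f (\<sigma>, Pos)"]
        independent_percolation_eq[OF X p(3,4), of i "\<lambda>\<epsilon>. f (\<epsilon>, Pos)"]
      unfolding W1_def W2_def assms(7,8) by metis
  qed

  have 4: "map_pmf fst (cond_pmf \<kappa> {s. snd s = b}) = pmf_of_set (Z b)"
    if "b \<in> set_pmf (map_pmf snd \<kappa>)" for b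
  proof -
    \<comment> \<open>If \<open>p1\<close> or \<open>p2\<close> is zero, then \<open>K b\<close> may vanish for some \<open>b\<close>; these lie outside the support.\<close>
    from that obtain f where "(f, b) \<in> set_pmf \<kappa>" by auto
    then have "pmf \<kappa> (f, b) \<noteq> 0" by (simp add: set_pmf_iff)
    moreover have "pmf \<kappa> (f, b) = (if (f, b) \<in> C \<times> B then w (f, b) / sum w (C \<times> B) else 0)"
      unfolding \<kappa> using C B w pos by (intro pmf_proportional_pmf) auto
    ultimately have fb: "f \<in> C" "b \<in> B" "w (f, b) \<noteq> 0"
      by (simp_all split: if_splits)
    then have K: "K b \<noteq> 0" "f \<in> Z b" by (auto simp: w_cocycle)
    have Z: "{f \<in> C. f \<in> Z b} = Z b"
      by (auto simp: Z_def C_def relative_cocycles_def relative_cochains_def split: prod.splits)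
    have "0 < w (f, b)" using fb(3) w[of "(f, b)"] by linarith
    then have "0 < (\<Sum>f\<in>C. w (f, b))"
      using fb(1) w C by (intro sum_pos2[of C f]) auto
    then have "map_pmf fst (cond_pmf \<kappa> {s. snd s = b}) = proportional_pmf C (\<lambda>f. w (f, b))"
      unfolding \<kappa> by (intro proportional_pmf_given_snd C B w fb)
    also have "\<dots> = proportional_pmf C (\<lambda>f. K b * of_bool (f \<in> Z b))"
      using fb by (intro proportional_pmf_cong) (simp add: w_cocycle)
    also have "\<dots> = pmf_of_set {f \<in> C. f \<in> Z b}"
      using K fb C by (simp add: proportional_pmf_scale proportional_pmf_of_bool bexI[of _ f])
    finally show ?thesis unfolding Z .
  qed

  have proj: "(\<lambda>(f, P2, P1). f) = (fst :: 'c cochain \<times> 'c set \<times> 'c set \<Rightarrow> _)"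
    "(\<lambda>(f, P2, P1). (P2, P1)) = (snd :: 'c cochain \<times> 'c set \<times> 'c set \<Rightarrow> _)"
    by auto
  have events: "{(g, P2, P1). g = f} = {s :: 'c cochain \<times> 'c set \<times> 'c set. fst s = f}"
    "{(f, Q2, Q1). Q2 = P2 \<and> Q1 = P1} = {s :: 'c cochain \<times> 'c set \<times> 'c set. snd s = (P2, P1)}"
    for f P2 P1
    by auto
  show ?thesis
    unfolding proj events using 1 2 3 4 by (auto simp: Z_def)
qed

end
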